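(* Let $K \subseteq L \subseteq \mathbb{R}$ be fields and let $A \in \theta(K,L)$. Then $A$ is linearly independent over $K$.
   Context: For fields $K \subseteq L$, a set $A$ belongs to $\theta(K,L)$ if and only if all five of the following hold: (i) $A \subseteq L$; (ii) $|A| \geqslant 2$ ($A$ may be infinite); (iii) for every $a \in A$ there is some $n \in \mathbb{N}=\{1,2,\dots\}$ with $a^{n} \in K$, and $n_a$ denotes the minimal such $n$; (iv) $A$ is pairwise linearly independent over $K$ (every two distinct elements of $A$ are linearly independent over $K$); (v) if $\operatorname{char}(K)>0$ then $\gcd(n_a,\operatorname{char}(K))=1$ for all $a \in A$. *)

theory Defs
  imports Complex_Main "HOL-Algebra.Algebraic_Closure_Type"
begin

text \<open>
  The ambient field is a type of class \<^class>\<open>Fields.field\<close>; its subfields are sets, recognised by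
  \<^locale>\<open>subfield\<close> applied to the ring record of the type.
\<close>

abbreviation is_subfield :: "'a::Fields.field set \<Rightarrow> bool" where
  "is_subfield K \<equiv> subfield K (ring_of_type_algebra :: 'a ring)"

lemma is_subfield_iff:
  fixes K :: "'a::Fields.field set"
  shows "is_subfield K \<longleftrightarrow>
    0 \<in> K \<and> 1 \<in> K \<and> (\<forall>x\<in>K. \<forall>y\<in>K. x - y \<in> K) \<and> (\<forall>x\<in>K. \<forall>y\<in>K. x * y \<in> K) \<and>
    (\<forall>x\<in>K. x \<noteq> 0 \<longrightarrow> inverse x \<in> K)"
proof -
  let ?R = "ring_of_type_algebra :: 'a ring"
  interpret R: field ?R by (rule field_from_type_algebra)
  have sel [simp]: "carrier ?R = UNIV" "\<zero>\<^bsub>?R\<^esub> = 0" "\<one>\<^bsub>?R\<^esub> = 1"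
      "x \<otimes>\<^bsub>?R\<^esub> y = x * y" "x \<oplus>\<^bsub>?R\<^esub> y = x + y" for x y
    by (simp_all add: ring_of_type_algebra_def)
  have uminus: "\<ominus>\<^bsub>?R\<^esub> x = - x" for x :: 'a
    by (rule R.minus_equality) auto
  have inverse: "inv\<^bsub>?R\<^esub> x = inverse x" if "x \<noteq> 0" for x :: 'a
    using that by (intro R.inv_char) auto
  show ?thesis (is "_ \<longleftrightarrow> ?P")
  proof
    assume K: "is_subfield K"
    note S = subringE[OF subfieldE(1)[OF K]]
    have "inverse x \<in> K" if "x \<in> K" "x \<noteq> 0" for x
      using R.subfield_m_inv(1)[OF K, of x] that by (simp add: inverse)
    moreover have "x - y \<in> K" if "x \<in> K" "y \<in> K" for x y
      using S(7)[of x "- y"] S(5)[of y] that by (simp add: uminus)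
    ultimately show ?P
      using S(2,3,6) by auto
  next
    assume P: ?P
    have neg: "- x \<in> K" if "x \<in> K" for x
      using P that by (metis diff_0)
    have add: "x + y \<in> K" if "x \<in> K" "y \<in> K" for x y
      using P that neg[of y] by (metis diff_minus_eq_add)
    have "subring K ?R"
      by (rule R.subringI) (use P neg add in \<open>auto simp: uminus\<close>)
    then show "is_subfield K"
      by (rule R.subfieldI') (use P in \<open>auto simp: inverse\<close>)
  qed
qed

text \<open>
  Same formula as the library's \<open>module.independent\<close>, except that the scalars range over
  the set \<open>K\<close> instead of a whole type.
\<close>

definition lin_independent_over :: "'a::Fields.field set \<Rightarrow> 'a set \<Rightarrow> bool" where
  "lin_independent_over K S \<longleftrightarrow>
     (\<forall>T c. finite T \<and> T \<subseteq> S \<and> (\<forall>v\<in>T. c v \<in> K) \<and> (\<Sum>v\<in>T. c v * v) = 0 \<longrightarrow> (\<forall>v\<in>T. c v = 0))"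

text \<open>The number \<open>n\<^sub>a\<close>; meaningful only when some positive power of \<open>a\<close> lies in \<open>K\<close>.\<close>

definition min_exponent :: "'a::Fields.field set \<Rightarrow> 'a \<Rightarrow> nat" where
  "min_exponent K a = (LEAST n. n > 0 \<and> a ^ n \<in> K)"

text \<open>
  A subfield has the characteristic of the ambient field, so \<open>CHAR('a)\<close> is the characteristic of \<open>K\<close>.
  The disjunct \<open>infinite A\<close> is needed since \<^const>\<open>card\<close> is 0 on infinite sets.
\<close>

definition theta :: "'a::Fields.field set \<Rightarrow> 'a set \<Rightarrow> 'a set set" where
  "theta K L = {A.
     A \<subseteq> L \<and>
     (infinite A \<or> card A \<ge> 2) \<and>
     (\<forall>a\<in>A. \<exists>n>0. a ^ n \<in> K) \<and>
     pairwise (\<lambda>a b. lin_independent_over K {a, b}) A \<and>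
     (CHAR('a) > 0 \<longrightarrow> (\<forall>a\<in>A. gcd (min_exponent K a) CHAR('a) = 1))}"

end

(* Let F be the field generated over K by finitely many real radicals. The trace of F over K kills every
   real radical b of F outside K: if d is the least positive exponent with b^d in K, the powers
   1, b, ..., b^(d-1) form a basis of K(b) over K, multiplication by b permutes them up to scalars
   without fixing any line, and the trace of F over K is a multiple of that of K(b) over K on K(b).
   In a dependency among pairwise independent radicals, divide by one of its terms: this term becomes 1,
   the others become radicals outside K, and taking traces gives [F : K] = 0. *)

theory Submission
  imports Defs "HOL-Computational_Algebra.Fundamental_Theorem_Algebra"
begin

section \<open>Closure of subfields and use of linear independence\<close>

lemma is_subfieldD:
  assumes "is_subfield K"
  shows "0 \<in> K" "1 \<in> K" "\<And>x y. x \<in> K \<Longrightarrow> y \<in> K \<Longrightarrow> x - y \<in> K"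
    "\<And>x y. x \<in> K \<Longrightarrow> y \<in> K \<Longrightarrow> x * y \<in> K" "\<And>x. x \<in> K \<Longrightarrow> inverse x \<in> K"
    "\<And>x. x \<in> K \<Longrightarrow> - x \<in> K" "\<And>x y. x \<in> K \<Longrightarrow> y \<in> K \<Longrightarrow> x + y \<in> K"
    "\<And>x y. x \<in> K \<Longrightarrow> y \<in> K \<Longrightarrow> x / y \<in> K" "\<And>x n. x \<in> K \<Longrightarrow> x ^ n \<in> K"
proof -
  note S = assms[unfolded is_subfield_iff]
  show "0 \<in> K" "1 \<in> K" and diff: "\<And>x y. x \<in> K \<Longrightarrow> y \<in> K \<Longrightarrow> x - y \<in> K"
    and mult: "\<And>x y. x \<in> K \<Longrightarrow> y \<in> K \<Longrightarrow> x * y \<in> K"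
    using S by auto
  show inv: "inverse x \<in> K" if "x \<in> K" for x
    using S that by (cases "x = 0") auto
  show neg: "- x \<in> K" if "x \<in> K" for x
    using diff[of 0 x] \<open>0 \<in> K\<close> that by simp
  show "x + y \<in> K" if "x \<in> K" "y \<in> K" for x y
    using diff[of x "- y"] neg[of y] that by simp
  show "x / y \<in> K" if "x \<in> K" "y \<in> K" for x y
    using mult[of x "inverse y"] inv[of y] that by (simp add: field_simps)
  show "x ^ n \<in> K" if "x \<in> K" for x n
    by (induction n) (use \<open>1 \<in> K\<close> mult that in auto)
qed

lemma is_subfield_sum:
  assumes "is_subfield K" "\<And>i. i \<in> I \<Longrightarrow> f i \<in> K"
  shows "sum f I \<in> K"
  using assms(2) by (induction I rule: infinite_finite_induct) (auto intro: is_subfieldD[OF assms(1)])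

lemma lin_independent_overD:
  assumes "lin_independent_over K S" "finite T" "T \<subseteq> S" "\<forall>v\<in>T. c v \<in> K" "(\<Sum>v\<in>T. c v * v) = 0" "v \<in> T"
  shows "c v = 0"
  using assms(1)[unfolded lin_independent_over_def, rule_format, of T c v] assms(2-) by blast

subsection \<open>Minimal polynomials of real radicals\<close>

text \<open>A nonzero \<open>p\<close> splits over the complex numbers, so \<open>poly p 0\<close>
  is, up to sign, the leading coefficient times the product of the roots, each of absolute value
  \<open>r\<close>.\<close>

lemma norm_coeff_0_eq:
  fixes p :: "complex poly"
  assumes "\<And>z. poly p z = 0 \<Longrightarrow> cmod z = r"
  shows "cmod (poly p 0) = cmod (lead_coeff p) * r ^ degree p"
proof (cases "p = 0")
  case False
  obtain root where root: "smult (lead_coeff p) (\<Prod>i<degree p. [:- root i, 1:]) = p"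
    using complex_poly_decompose' .
  have eval: "poly p z = lead_coeff p * (\<Prod>i<degree p. z - root i)" for z
    by (subst root [symmetric]) (simp add: poly_prod)
  have "cmod (root i) = r" if "i < degree p" for i
    by (rule assms) (subst eval, use that in auto)
  then show ?thesis
    by (subst eval) (simp add: norm_mult prod_norm[symmetric])
qed auto

text \<open>Polynomials have coefficients in the whole type, so the point is that the remainder
  stays over \<open>K\<close>. To divide \<open>pCons a p\<close>, the remainder of \<open>p\<close>
  is shifted by one degree and at most one leading term is cancelled, using a quotient of elements
  of \<open>K\<close>.\<close>

lemma poly_division_over_subfield:
  fixes p g :: "'a::Fields.field poly"
  assumes K: "is_subfield K" and p: "\<forall>i. coeff p i \<in> K" and g: "\<forall>i. coeff g i \<in> K" "g \<noteq> 0"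
  shows "\<exists>q r. p = q * g + r \<and> (\<forall>i. coeff r i \<in> K) \<and> (r = 0 \<or> degree r < degree g)"
  using p
proof (induction p)
  case 0
  have "0 = 0 * g + 0 \<and> (\<forall>i. coeff (0::'a poly) i \<in> K) \<and> ((0::'a poly) = 0 \<or> degree (0::'a poly) < degree g)"
    using is_subfieldD(1)[OF K] by simp
  then show ?case by blast
next
  case (pCons a p)
  have p: "coeff p i \<in> K" for i
    using pCons.prems[rule_format, of "Suc i"] by simp
  have a: "a \<in> K"
    using pCons.prems[rule_format, of 0] by simp
  obtain q r where qr: "p = q * g + r" "\<forall>i. coeff r i \<in> K" "r = 0 \<or> degree r < degree g"
    using pCons.IH p by blast
  define s where "s = pCons a r"
  \<comment> \<open>The shift raises the degree of the remainder to at most \<open>degree g\<close>.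
    If the coefficient there is 0, so is \<open>c\<close>, and nothing is subtracted.\<close>
  define c where "c = coeff s (degree g) / lead_coeff g"
  have s: "coeff s i \<in> K" for i
    using a qr(2) by (cases i) (auto simp: s_def)
  have "c \<in> K"
    unfolding c_def using s g by (intro is_subfieldD(8)[OF K]) auto
  have eq: "pCons a p = (pCons 0 q + [:c:]) * g + (s - smult c g)"
    by (simp add: qr(1) s_def algebra_simps)
  have r: "coeff (s - smult c g) i \<in> K" for i
    using s g \<open>c \<in> K\<close> by (auto intro!: is_subfieldD[OF K])
  have "degree s \<le> degree g"
    using qr(3) by (auto simp: s_def degree_pCons_eq_if)
  then have "degree (s - smult c g) \<le> degree g"
    by (intro degree_diff_le) auto
  moreover have "coeff (s - smult c g) (degree g) = 0"
    using g(2) by (simp add: c_def)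
  ultimately have "s - smult c g = 0 \<or> degree (s - smult c g) < degree g"
    using eq_zero_or_degree_less by blast
  with eq r show ?case by blast
qed

text \<open>All complex roots of a factor of \<open>x ^ d - b ^ d\<close> have absolute value \<open>\<bar>b\<bar>\<close>, so for a real
  factor of degree \<open>k\<close> over \<open>K\<close> the constant coefficient exhibits \<open>b ^ k\<close> as an element of \<open>K\<close>.\<close>

lemma real_radical_degree:
  fixes b :: real
  assumes K: "is_subfield K" and d: "b ^ d \<in> K" "\<And>k. 0 < k \<Longrightarrow> k < d \<Longrightarrow> b ^ k \<notin> K"
    and p: "\<forall>i. coeff p i \<in> K" "poly p b = 0" "degree p < d"
  shows "p = 0"
proof (rule ccontr)
  assume "p \<noteq> 0"
  \<comment> \<open>A polynomial of least degree satisfying \<open>P\<close> is, up to a scalar, the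
    minimal polynomial of \<open>b\<close> over \<open>K\<close>; minimality then makes it divide
    x^d - b^d.\<close>
  define P where "P g \<longleftrightarrow> g \<noteq> 0 \<and> (\<forall>i. coeff g i \<in> K) \<and> poly g b = 0" for g
  have "P p"
    using \<open>p \<noteq> 0\<close> p by (simp add: P_def)
  then obtain g where g: "P g" and min: "\<And>h. P h \<Longrightarrow> degree g \<le> degree h"
    using ex_has_least_nat[of P p degree] by auto
  define f where "f = monom 1 d - [:b ^ d:]"
  have f: "coeff f i \<in> K" for i
    unfolding f_def coeff_diff
    by (intro is_subfieldD[OF K]) (auto simp: coeff_monom coeff_pCons d is_subfieldD[OF K] split: nat.splits)
  obtain q r where qr: "f = q * g + r" "\<forall>i. coeff r i \<in> K" "r = 0 \<or> degree r < degree g"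
    using poly_division_over_subfield[OF K, of f g] f g by (auto simp: P_def)
  have "poly f b = 0"
    by (simp add: f_def poly_monom)
  then have "poly r b = 0"
    using g qr(1) by (simp add: P_def)
  then have "r = 0"
    using min[of r] qr by (auto simp: P_def not_le[symmetric])
  have "degree g < d"
    using min[OF \<open>P p\<close>] p(3) by simp
  have roots: "cmod z = \<bar>b\<bar>" if "poly (map_poly complex_of_real g) z = 0" for z
  proof -
    have "map_poly complex_of_real f = map_poly of_real q * map_poly of_real g"
      unfolding qr(1) \<open>r = 0\<close> by (simp add: poly_eq_iff coeff_map_poly coeff_mult)
    then have "poly (map_poly complex_of_real f) z = 0"
      using that by simp
    moreover have "map_poly complex_of_real f = monom 1 d - [:of_real b ^ d:]"
      by (auto simp: f_def poly_eq_iff coeff_map_poly coeff_monom coeff_pCons split: nat.splits)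
    ultimately have "z ^ d = of_real b ^ d"
      by (simp add: poly_monom)
    then have "cmod z ^ d = \<bar>b\<bar> ^ d"
      by (metis norm_of_real norm_power)
    then show ?thesis
      using \<open>degree g < d\<close> by (subst (asm) power_eq_iff_eq_base) auto
  qed
  have deg: "degree (map_poly complex_of_real g) = degree g"
    by (rule degree_map_poly) auto
  have "cmod (of_real (poly g 0)) = cmod (of_real (lead_coeff g)) * \<bar>b\<bar> ^ degree g"
    using norm_coeff_0_eq[of "map_poly complex_of_real g", OF roots] by (simp add: deg coeff_map_poly poly_0_coeff_0)
  then have "\<bar>b ^ degree g\<bar> = \<bar>coeff g 0 / lead_coeff g\<bar>"
    using g by (simp add: P_def poly_0_coeff_0 power_abs abs_mult field_simps)
  \<comment> \<open>Here \<open>b\<close> being real matters: its powers are determined up to sign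
    by their absolute values, and \<open>K\<close> is closed under negation.\<close>
  then have "b ^ degree g = coeff g 0 / lead_coeff g \<or> b ^ degree g = - (coeff g 0 / lead_coeff g)"
    by (simp only: abs_eq_iff)
  moreover have "coeff g 0 / lead_coeff g \<in> K"
    using g by (intro is_subfieldD[OF K]) (auto simp: P_def)
  ultimately have "b ^ degree g \<in> K"
    using is_subfieldD(6)[OF K] by metis
  moreover have "degree g > 0"
    using g by (auto simp: P_def elim!: degree_eq_zeroE intro!: Nat.gr0I)
  ultimately show False
    using d(2) \<open>degree g < d\<close> by blast
qed

subsection \<open>Coordinates and traces\<close>

text \<open>A basis \<open>e\<close> of the \<open>K\<close>-space \<open>F\<close> together with its coordinate functions \<open>\<phi>\<close>. Of the duality
  relations between the two, only the diagonal ones are recorded.\<close>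

definition frame :: "'a::Fields.field set \<Rightarrow> 'a set \<Rightarrow> 'i set \<Rightarrow> ('i \<Rightarrow> 'a) \<Rightarrow> ('i \<Rightarrow> 'a \<Rightarrow> 'a) \<Rightarrow> bool" where
  "frame K F I e \<phi> \<longleftrightarrow> finite I \<and> (\<forall>i\<in>I. e i \<in> F \<and> \<phi> i (e i) = 1 \<and>
      (\<forall>v\<in>F. \<phi> i v \<in> K \<and> (\<forall>w\<in>F. \<phi> i (v + w) = \<phi> i v + \<phi> i w) \<and> (\<forall>k\<in>K. \<phi> i (k * v) = k * \<phi> i v))) \<and>
      (\<forall>v\<in>F. v = (\<Sum>i\<in>I. \<phi> i v * e i))"

text \<open>The trace of multiplication by \<open>x\<close> as a \<open>K\<close>-linear map: the
  summands are the diagonal entries of its matrix in the basis \<open>e\<close>.\<close>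

definition frame_trace :: "'i set \<Rightarrow> ('i \<Rightarrow> 'a::Fields.field) \<Rightarrow> ('i \<Rightarrow> 'a \<Rightarrow> 'a) \<Rightarrow> 'a \<Rightarrow> 'a" where
  "frame_trace I e \<phi> x = (\<Sum>i\<in>I. \<phi> i (x * e i))"

lemma frame_sum:
  assumes "frame K F I e \<phi>" "is_subfield F" "i \<in> I" "\<And>j. j \<in> J \<Longrightarrow> f j \<in> F"
  shows "\<phi> i (\<Sum>j\<in>J. f j) = (\<Sum>j\<in>J. \<phi> i (f j))"
proof -
  have add: "\<phi> i (v + w) = \<phi> i v + \<phi> i w" if "v \<in> F" "w \<in> F" for v w
    using assms(1,3) that unfolding frame_def by blast
  have "\<phi> i 0 = 0"
    using add[of 0 0] is_subfieldD(1)[OF assms(2)] by (metis add_0_left add_cancel_left_left)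
  with assms(4) show ?thesis
    by (induction J rule: infinite_finite_induct) (auto simp: add is_subfield_sum[OF assms(2)])
qed

text \<open>This is tr(AB) = tr(BA) for a change of basis: expand each \<open>e i\<close> in the
  basis \<open>f\<close>, move the scalars out of \<open>\<phi>\<close>, swap the two sums, move the
  other scalars into \<open>\<psi>\<close>, and contract.\<close>

lemma frame_trace_unique:
  assumes \<phi>: "frame K F I e \<phi>" and \<psi>: "frame K F J f \<psi>"
    and F: "is_subfield F" and "K \<subseteq> F" and x: "x \<in> F"
  shows "frame_trace I e \<phi> x = frame_trace J f \<psi> x"
proof -
  have e: "e i \<in> F" if "i \<in> I" for i
    using \<phi> that by (auto simp: frame_def)
  have f: "f j \<in> F" if "j \<in> J" for j
    using \<psi> that by (auto simp: frame_def)
  have \<phi>K: "\<phi> i v \<in> K" if "i \<in> I" "v \<in> F" for i v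
    using \<phi> that by (auto simp: frame_def)
  have \<psi>K: "\<psi> j v \<in> K" if "j \<in> J" "v \<in> F" for j v
    using \<psi> that by (auto simp: frame_def)
  have \<phi>scale: "\<phi> i (k * v) = k * \<phi> i v" if "i \<in> I" "k \<in> K" "v \<in> F" for i k v
    using \<phi> that by (auto simp: frame_def)
  have \<psi>scale: "\<psi> j (k * v) = k * \<psi> j v" if "j \<in> J" "k \<in> K" "v \<in> F" for j k v
    using \<psi> that by (auto simp: frame_def)
  have e_eq: "e i = (\<Sum>j\<in>J. \<psi> j (e i) * f j)" if "i \<in> I" for i
    using \<psi> e[OF that] unfolding frame_def by blast
  have \<phi>_eq: "v = (\<Sum>i\<in>I. \<phi> i v * e i)" if "v \<in> F" for v
    using \<phi> that unfolding frame_def by blast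
  note F_mult = is_subfieldD(4)[OF F]
  have "frame_trace I e \<phi> x = (\<Sum>i\<in>I. \<phi> i (\<Sum>j\<in>J. \<psi> j (e i) * (x * f j)))"
    unfolding frame_trace_def
  proof (rule sum.cong)
    fix i assume "i \<in> I"
    have "x * e i = (\<Sum>j\<in>J. \<psi> j (e i) * (x * f j))"
      by (subst e_eq[OF \<open>i \<in> I\<close>]) (simp add: sum_distrib_left mult_ac)
    then show "\<phi> i (x * e i) = \<phi> i (\<Sum>j\<in>J. \<psi> j (e i) * (x * f j))" by simp
  qed simp
  also have "\<dots> = (\<Sum>i\<in>I. \<Sum>j\<in>J. \<psi> j (e i) * \<phi> i (x * f j))"
  proof (rule sum.cong)
    fix i assume i: "i \<in> I"
    have "\<psi> j (e i) * (x * f j) \<in> F" if "j \<in> J" for j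
      using \<psi>K[OF that e[OF i]] f[OF that] x \<open>K \<subseteq> F\<close> F_mult by blast
    then have "\<phi> i (\<Sum>j\<in>J. \<psi> j (e i) * (x * f j)) = (\<Sum>j\<in>J. \<phi> i (\<psi> j (e i) * (x * f j)))"
      by (rule frame_sum[OF \<phi> F i])
    also have "\<dots> = (\<Sum>j\<in>J. \<psi> j (e i) * \<phi> i (x * f j))"
      using i by (intro sum.cong refl \<phi>scale \<psi>K e F_mult x f)
    finally show "\<phi> i (\<Sum>j\<in>J. \<psi> j (e i) * (x * f j)) = (\<Sum>j\<in>J. \<psi> j (e i) * \<phi> i (x * f j))" .
  qed simp
  \<comment> \<open>The roles change here: \<open>\<phi> i (x * f j)\<close> lies in
    \<open>K\<close> and becomes the scalar, so that the sum over \<open>i\<close> turns into the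
    expansion of \<open>x * f j\<close> in the basis \<open>e\<close>.\<close>
  also have "\<dots> = (\<Sum>j\<in>J. \<Sum>i\<in>I. \<psi> j (\<phi> i (x * f j) * e i))"
    by (subst sum.swap) (intro sum.cong refl, simp add: \<psi>scale \<phi>K e f x F_mult)
  also have "\<dots> = (\<Sum>j\<in>J. \<psi> j (\<Sum>i\<in>I. \<phi> i (x * f j) * e i))"
  proof (rule sum.cong)
    fix j assume j: "j \<in> J"
    have "\<phi> i (x * f j) * e i \<in> F" if "i \<in> I" for i
      using \<phi>K[OF that F_mult[OF x f[OF j]]] e[OF that] \<open>K \<subseteq> F\<close> F_mult by blast
    then show "(\<Sum>i\<in>I. \<psi> j (\<phi> i (x * f j) * e i)) = \<psi> j (\<Sum>i\<in>I. \<phi> i (x * f j) * e i)"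
      by (rule frame_sum[OF \<psi> F j, symmetric])
  qed simp
  also have "\<dots> = frame_trace J f \<psi> x"
    unfolding frame_trace_def using \<phi>_eq F_mult[OF x f] by (intro sum.cong refl) metis
  finally show ?thesis .
qed

text \<open>The product basis of a tower: take the coordinate over \<open>E\<close> first, then its
  coordinate over \<open>K\<close>. Multiplication by \<open>x\<close> in \<open>E\<close> preserves
  each of the \<open>card J\<close> summands \<open>E * f j\<close> and acts on each as on
  \<open>E\<close>, whence the factor in the trace.\<close>

lemma frame_tower:
  assumes \<psi>: "frame E F J f \<psi>" and \<chi>: "frame K E I e \<chi>"
    and E: "is_subfield E" and F: "is_subfield F" and "K \<subseteq> E" "E \<subseteq> F"
  shows "frame K F (I \<times> J) (\<lambda>(i, j). e i * f j) (\<lambda>(i, j) v. \<chi> i (\<psi> j v))"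
    and "x \<in> E \<Longrightarrow> frame_trace (I \<times> J) (\<lambda>(i, j). e i * f j) (\<lambda>(i, j) v. \<chi> i (\<psi> j v)) x
      = of_nat (card J) * frame_trace I e \<chi> x"
proof -
  have e: "e i \<in> E" "\<chi> i (e i) = 1" if "i \<in> I" for i
    using \<chi> that by (auto simp: frame_def)
  have f: "f j \<in> F" "\<psi> j (f j) = 1" if "j \<in> J" for j
    using \<psi> that by (auto simp: frame_def)
  have \<chi>K: "\<chi> i v \<in> K" "k \<in> K \<Longrightarrow> \<chi> i (k * v) = k * \<chi> i v" "w \<in> E \<Longrightarrow> \<chi> i (v + w) = \<chi> i v + \<chi> i w"
    if "i \<in> I" "v \<in> E" for i k v w
    using \<chi> that by (auto simp: frame_def)
  have \<psi>E: "\<psi> j v \<in> E" "k \<in> E \<Longrightarrow> \<psi> j (k * v) = k * \<psi> j v" "w \<in> F \<Longrightarrow> \<psi> j (v + w) = \<psi> j v + \<psi> j w"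
    if "j \<in> J" "v \<in> F" for j k v w
    using \<psi> that by (auto simp: frame_def)
  \<comment> \<open>By \<open>E\<close>-linearity the diagonal relation covers all multiples of
    \<open>f j\<close>; this yields both the diagonal relation and the diagonal entries for the
    product basis.\<close>
  have diag: "\<psi> j (k * f j) = k" if "j \<in> J" "k \<in> E" for j k
    using \<psi>E(2)[of j "f j" k] f that by simp
  have fin: "finite I" "finite J"
    using \<psi> \<chi> by (auto simp: frame_def)
  have eq: "v = (\<Sum>p\<in>I \<times> J. (case p of (i, j) \<Rightarrow> \<chi> i (\<psi> j v)) * (case p of (i, j) \<Rightarrow> e i * f j))"
    if "v \<in> F" for v
  proof -
    have "v = (\<Sum>j\<in>J. \<psi> j v * f j)"
      using \<psi> that unfolding frame_def by blast
    also have "\<dots> = (\<Sum>j\<in>J. (\<Sum>i\<in>I. \<chi> i (\<psi> j v) * e i) * f j)"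
    proof (intro sum.cong refl arg_cong2[where f = "(*)"])
      fix j assume "j \<in> J"
      then show "\<psi> j v = (\<Sum>i\<in>I. \<chi> i (\<psi> j v) * e i)"
        using \<chi> \<psi>E(1)[of j v] that unfolding frame_def by blast
    qed
    also have "\<dots> = (\<Sum>i\<in>I. \<Sum>j\<in>J. \<chi> i (\<psi> j v) * (e i * f j))"
      by (subst sum.swap) (simp add: sum_distrib_right mult.assoc)
    finally show ?thesis
      by (simp add: sum.cartesian_product case_prod_beta)
  qed
  show "frame K F (I \<times> J) (\<lambda>(i, j). e i * f j) (\<lambda>(i, j) v. \<chi> i (\<psi> j v))"
    unfolding frame_def
  proof (intro conjI ballI)
    fix p assume p: "p \<in> I \<times> J"
    obtain i j where [simp]: "p = (i, j)" "i \<in> I" "j \<in> J" using p by auto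
    show "(case p of (i, j) \<Rightarrow> e i * f j) \<in> F"
      using e f \<open>E \<subseteq> F\<close> by (auto intro!: is_subfieldD(4)[OF F])
    show "(case p of (i, j) \<Rightarrow> \<lambda>v. \<chi> i (\<psi> j v)) (case p of (i, j) \<Rightarrow> e i * f j) = 1"
      by (simp add: diag e)
    fix v assume v: "v \<in> F"
    show "(case p of (i, j) \<Rightarrow> \<lambda>v. \<chi> i (\<psi> j v)) v \<in> K"
      using v by (simp add: \<chi>K \<psi>E)
    show "(case p of (i, j) \<Rightarrow> \<lambda>v. \<chi> i (\<psi> j v)) (v + w) =
      (case p of (i, j) \<Rightarrow> \<lambda>v. \<chi> i (\<psi> j v)) v + (case p of (i, j) \<Rightarrow> \<lambda>v. \<chi> i (\<psi> j v)) w" if "w \<in> F" for w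
      using v that by (simp add: \<chi>K \<psi>E)
    show "(case p of (i, j) \<Rightarrow> \<lambda>v. \<chi> i (\<psi> j v)) (k * v) = k * (case p of (i, j) \<Rightarrow> \<lambda>v. \<chi> i (\<psi> j v)) v"
      if "k \<in> K" for k
      using v that \<open>K \<subseteq> E\<close> by (simp add: \<chi>K \<psi>E subset_iff)
  qed (use fin eq in \<open>auto simp: case_prod_beta\<close>)
  show "frame_trace (I \<times> J) (\<lambda>(i, j). e i * f j) (\<lambda>(i, j) v. \<chi> i (\<psi> j v)) x
      = of_nat (card J) * frame_trace I e \<chi> x" if "x \<in> E"
  proof -
    have "\<psi> j (x * (e i * f j)) = x * e i" if "i \<in> I" "j \<in> J" for i j
      using diag[of j "x * e i"] that \<open>x \<in> E\<close> e is_subfieldD(4)[OF E] by (simp add: mult.assoc)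
    then have "frame_trace (I \<times> J) (\<lambda>(i, j). e i * f j) (\<lambda>(i, j) v. \<chi> i (\<psi> j v)) x
        = (\<Sum>i\<in>I. \<Sum>j\<in>J. \<chi> i (x * e i))"
      unfolding frame_trace_def sum.cartesian_product by (intro sum.cong) auto
    then show ?thesis
      by (simp add: frame_trace_def sum_distrib_left)
  qed
qed

text \<open>Coordinates are chosen by \<open>SOME\<close>; independence makes the choice unique, and
  linearity follows from uniqueness. The last conjunct allows reading coordinates off any explicit
  combination, as needed to compute matrix entries.\<close>

lemma frame_of_unique_representation:
  assumes K: "is_subfield K" and fin: "finite I"
    and F: "F = {\<Sum>i\<in>I. c i * e i | c. \<forall>i\<in>I. c i \<in> K}"
    and indep: "\<And>c. \<lbrakk>\<forall>i\<in>I. c i \<in> K; (\<Sum>i\<in>I. c i * e i) = 0\<rbrakk> \<Longrightarrow> \<forall>i\<in>I. c i = 0"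
  shows "\<exists>\<phi>. frame K F I e \<phi> \<and>
    (\<forall>c. (\<forall>i\<in>I. c i \<in> K) \<longrightarrow> (\<forall>i\<in>I. \<phi> i (\<Sum>i\<in>I. c i * e i) = c i))"
proof -
  define rep where "rep v = (SOME c. (\<forall>i\<in>I. c i \<in> K) \<and> v = (\<Sum>i\<in>I. c i * e i))" for v
  have rep: "(\<forall>i\<in>I. rep v i \<in> K) \<and> v = (\<Sum>i\<in>I. rep v i * e i)" if "v \<in> F" for v
  proof -
    have "\<exists>c. (\<forall>i\<in>I. c i \<in> K) \<and> v = (\<Sum>i\<in>I. c i * e i)"
      using that unfolding F by blast
    then show ?thesis
      unfolding rep_def by (rule someI_ex)
  qed
  have rep_eq: "rep v i = c i" if "\<forall>i\<in>I. c i \<in> K" "v = (\<Sum>i\<in>I. c i * e i)" "i \<in> I" for v c i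
  proof -
    have "v \<in> F" using that F by auto
    note r = rep[OF this]
    have "(\<Sum>i\<in>I. (rep v i - c i) * e i) = 0"
      using r that(2) by (simp add: algebra_simps sum_subtractf)
    moreover have "\<forall>i\<in>I. rep v i - c i \<in> K"
      using r that by (auto intro: is_subfieldD[OF K])
    ultimately have "\<forall>i\<in>I. rep v i - c i = 0"
      using indep[of "\<lambda>i. rep v i - c i"] by blast
    with that show ?thesis by auto
  qed
  have unit: "(\<Sum>j\<in>I. (if j = i then 1 else 0) * e j) = e i" if "i \<in> I" for i
    using that fin by (simp add: if_distrib[of "\<lambda>x. x * _"] cong: if_cong)
  have "frame K F I e (\<lambda>i v. rep v i)"
    unfolding frame_def
  proof (intro conjI ballI)
    fix i assume i: "i \<in> I"
    show "rep (e i) i = 1"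
      using rep_eq[of "\<lambda>j. if j = i then 1 else 0" "e i" i] i unit[OF i] is_subfieldD(1,2)[OF K] by auto
    have "\<forall>j\<in>I. (if j = i then 1 else 0) \<in> K"
      using is_subfieldD(1,2)[OF K] by auto
    then show "e i \<in> F"
      unfolding F mem_Collect_eq using unit[OF i, symmetric]
      by (intro exI[of _ "\<lambda>j. if j = i then 1 else 0"]) blast
    fix v assume v: "v \<in> F"
    show "rep v i \<in> K" using rep[OF v] i by blast
    show "rep (v + w) i = rep v i + rep w i" if w: "w \<in> F" for w
      using rep[OF v] rep[OF w] i
      by (intro rep_eq) (auto simp: algebra_simps sum.distrib intro: is_subfieldD[OF K])
    show "rep (k * v) i = k * rep v i" if k: "k \<in> K" for k
    proof (intro rep_eq)
      show "k * v = (\<Sum>i\<in>I. k * rep v i * e i)"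
        by (subst conjunct2[OF rep[OF v]]) (simp add: sum_distrib_left mult.assoc)
    qed (use rep[OF v] i k in \<open>auto intro: is_subfieldD[OF K]\<close>)
  qed (use rep fin in auto)
  with rep_eq show ?thesis by blast
qed


subsection \<open>Finite radical extensions\<close>

text \<open>The ring obtained by adjoining the listed elements successively. For radicals, which are
  algebraic, it is the field they generate over \<open>K\<close>.\<close>

abbreviation radical_extension :: "'a::Fields.field set \<Rightarrow> 'a list \<Rightarrow> 'a set" where
  "radical_extension \<equiv> ring.finite_extension (ring_of_type_algebra :: 'a ring)"

lemma ring_of_type_algebra_simps:
  fixes x y :: "'a::Fields.field"
  defines "R \<equiv> ring_of_type_algebra :: 'a ring"
  shows "carrier R = UNIV" "\<zero>\<^bsub>R\<^esub> = 0" "\<one>\<^bsub>R\<^esub> = 1" "x \<otimes>\<^bsub>R\<^esub> y = x * y" "x \<oplus>\<^bsub>R\<^esub> y = x + y"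
    "x [^]\<^bsub>R\<^esub> n = x ^ n" "length xs = length ys \<Longrightarrow> ring.combine R xs ys = (\<Sum>i<length ys. xs ! i * ys ! i)"
proof -
  interpret R: field R
    unfolding R_def by (rule field_from_type_algebra)
  show sel: "carrier R = UNIV" "\<zero>\<^bsub>R\<^esub> = 0" "\<one>\<^bsub>R\<^esub> = 1" "x \<otimes>\<^bsub>R\<^esub> y = x * y" "x \<oplus>\<^bsub>R\<^esub> y = x + y" for x y :: 'a
    by (simp_all add: R_def ring_of_type_algebra_def)
  show "x [^]\<^bsub>R\<^esub> n = x ^ n"
    by (induction n) (simp_all add: sel mult.commute)
  show "R.combine xs ys = (\<Sum>i<length ys. xs ! i * ys ! i)" if "length xs = length ys"
    using that by (induction xs ys rule: list_induct2) (simp_all add: sel sum.lessThan_Suc_shift del: sum.lessThan_Suc)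
qed

lemma algebraic_of_power:
  fixes x :: "'a::Fields.field"
  assumes K: "is_subfield K" and n: "0 < n" "x ^ n \<in> K"
  shows "ring.algebraic (ring_of_type_algebra :: 'a ring) K x"
proof -
  define R where "R = (ring_of_type_algebra :: 'a ring)"
  interpret R: field R
    unfolding R_def by (rule field_from_type_algebra)
  note [simp] = ring_of_type_algebra_simps[where 'a = 'a, folded R_def]
  \<comment> \<open>The polynomial X^n - x^n as a list of coefficients, leading one first, with n -
    1 zeros in between.\<close>
  let ?p = "1 # replicate (n - 1) 0 @ [- (x ^ n)]"
  have "?p \<in> carrier (K [X]\<^bsub>R\<^esub>)"
    using n is_subfieldD[OF K] by (auto simp: univ_poly_def polynomial_def)
  moreover have "R.eval (replicate (n - 1) 0 @ [- (x ^ n)]) x = - (x ^ n)"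
    using R.eval_replicate[of "[- (x ^ n)]" x "n - 1"] by simp
  then have "R.eval ?p x = \<zero>\<^bsub>R\<^esub>"
    using n by simp
  ultimately have "R.algebraic K x"
    using R.algebraicI[of ?p K x] by (simp add: over_def)
  then show ?thesis
    by (simp add: R_def over_def)
qed

text \<open>Radicals are algebraic, so finitely many of them generate a field of finite dimension
  over \<open>K\<close>. A base given as a list becomes a frame indexed by the positions in the
  list.\<close>

lemma radical_extension:
  fixes xs :: "'a::Fields.field list"
  assumes K: "is_subfield K" and xs: "\<forall>x\<in>set xs. \<exists>n>0. x ^ n \<in> K"
  shows "is_subfield (radical_extension K xs)" "K \<subseteq> radical_extension K xs"
    "set xs \<subseteq> radical_extension K xs"
    "\<And>E. is_subfield E \<Longrightarrow> K \<subseteq> E \<Longrightarrow> set xs \<subseteq> E \<Longrightarrow> radical_extension K xs \<subseteq> E"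
    "\<And>E. K \<subseteq> E \<Longrightarrow> radical_extension K xs \<subseteq> radical_extension E xs"
    "\<exists>(I :: nat set) e \<phi>. frame K (radical_extension K xs) I e \<phi>"
proof -
  define R where "R = (ring_of_type_algebra :: 'a ring)"
  interpret R: field R
    unfolding R_def by (rule field_from_type_algebra)
  note [simp] = ring_of_type_algebra_simps[where 'a = 'a, folded R_def]
  note KR = K[folded R_def]
  have alg: "R.algebraic K x" if "x \<in> set xs" for x
    using algebraic_of_power[OF K] xs that unfolding R_def by blast
  show "is_subfield (radical_extension K xs)"
    using R.finite_extension_is_subfield[OF KR, of xs] alg by (simp add: R_def[symmetric] over_def)
  show "K \<subseteq> radical_extension K xs"
    using R.finite_extension_incl[of K xs] by (simp add: R_def[symmetric])
  show "set xs \<subseteq> radical_extension K xs"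
    using R.finite_extension_mem[OF subfieldE(1)[OF KR], of xs] by (simp add: R_def[symmetric])
  show "radical_extension K xs \<subseteq> E" if "is_subfield E" "K \<subseteq> E" "set xs \<subseteq> E" for E
    using R.finite_extension_subring_incl[OF subfieldE(1)] that by (simp add: R_def[symmetric])
  show "radical_extension K xs \<subseteq> radical_extension E xs" if "K \<subseteq> E" for E
    using R.mono_finite_extension[OF that] by (simp add: R_def[symmetric])
  have "R.finite_dimension K (R.finite_extension K xs)"
    using R.finite_extension_finite_dimension(1)[OF KR, of xs] alg by (simp add: over_def)
  then obtain n where "R.dimension n K (R.finite_extension K xs)"
    by (rule R.finite_dimensionE')
  then obtain us where us: "R.independent K us" "length us = n" "R.Span K us = R.finite_extension K xs"
    using R.exists_base[OF KR] by blast
  have list: "\<exists>ks. set ks \<subseteq> K \<and> length ks = length us \<and> (\<forall>i<length us. ks ! i = c i)"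
    if "\<forall>i<length us. c i \<in> K" for c
    using that by (intro exI[of _ "map c [0..<length us]"]) auto
  have comb: "R.combine ks us = (\<Sum>i<length us. ks ! i * us ! i)" if "length ks = length us" for ks
    using that by simp
  \<comment> \<open>The span of \<open>us\<close> is rewritten with coefficient functions on
    positions in place of coefficient lists.\<close>
  have "R.finite_extension K xs = {\<Sum>i\<in>{..<length us}. c i * us ! i | c. \<forall>i\<in>{..<length us}. c i \<in> K}"
    (is "?F = ?S")
  proof (intro Set.set_eqI iffI)
    fix v assume "v \<in> ?F"
    then obtain ks where "set ks \<subseteq> K" "length ks = length us" "v = R.combine ks us"
      using R.unique_decomposition[OF KR us(1), of v] us(3) by blast
    then show "v \<in> ?S"
      by (auto simp: subset_iff intro!: exI[of _ "\<lambda>i. ks ! i"])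
  next
    fix v assume "v \<in> ?S"
    then obtain c where c: "\<forall>i<length us. c i \<in> K" "v = (\<Sum>i<length us. c i * us ! i)" by auto
    with list obtain ks where "set ks \<subseteq> K" "length ks = length us" "\<forall>i<length us. ks ! i = c i" by blast
    with c have "v = R.combine ks us" "set ks \<subseteq> K" by auto
    then show "v \<in> ?F"
      using R.Span_eq_combine_set[OF KR, of us] us(3) by auto
  qed
  moreover have "\<forall>i\<in>{..<length us}. c i = 0"
    if c: "\<forall>i\<in>{..<length us}. c i \<in> K" "(\<Sum>i<length us. c i * us ! i) = 0" for c
  proof -
    obtain ks where ks: "set ks \<subseteq> K" "length ks = length us" "\<forall>i<length us. ks ! i = c i"
      using list c by blast
    then have "R.combine ks us = 0"
      using c(2) by simp
    then have "set (take (length us) ks) \<subseteq> {0}"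
      using R.independent_imp_trivial_combine[OF KR us(1), of ks] ks by simp
    with ks show ?thesis
      by (metis lessThan_iff nth_mem order_refl singletonD subsetD take_all)
  qed
  ultimately have "\<exists>\<phi>. frame K ?F {..<length us} ((!) us) \<phi>"
    using frame_of_unique_representation[OF K, of "{..<length us}" ?F "(!) us"] by blast
  then show "\<exists>(I :: nat set) e \<phi>. frame K (radical_extension K xs) I e \<phi>"
    unfolding R_def by blast
qed

subsection \<open>The trace of a real radical\<close>

text \<open>The powers span because elements of the extension arise by Horner steps
  \<open>v * b + k\<close> and \<open>b ^ d\<close> falls back into \<open>K\<close>. They are
  independent by \<open>real_radical_degree\<close>.\<close>

lemma frame_of_real_radical:
  fixes b :: real
  assumes K: "is_subfield K" and d: "0 < d" "b ^ d \<in> K" "\<And>k. 0 < k \<Longrightarrow> k < d \<Longrightarrow> b ^ k \<notin> K"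
  shows "\<exists>\<phi>. frame K (radical_extension K [b]) {..<d} (\<lambda>i. b ^ i) \<phi> \<and>
    (\<forall>c. (\<forall>i<d. c i \<in> K) \<longrightarrow> (\<forall>i<d. \<phi> i (\<Sum>i<d. c i * b ^ i) = c i))"
proof -
  define R where "R = (ring_of_type_algebra :: real ring)"
  interpret R: field R
    unfolding R_def by (rule field_from_type_algebra)
  note [simp] = ring_of_type_algebra_simps[where 'a = real, folded R_def]
  let ?S = "{\<Sum>i\<in>{..<d}. c i * b ^ i | c. \<forall>i\<in>{..<d}. c i \<in> K}"
  have E: "is_subfield (radical_extension K [b])" "K \<subseteq> radical_extension K [b]" "b \<in> radical_extension K [b]"
    using radical_extension[OF K, of "[b]"] d by auto
  have "radical_extension K [b] = ?S"
  proof (intro Set.set_eqI iffI)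
    fix v assume "v \<in> radical_extension K [b]"
    then have "v \<in> R.simple_extension K b"
      by (simp add: R_def[symmetric])
    then show "v \<in> ?S"
    proof induction
      case zero
      then show ?case
        using is_subfieldD(1)[OF K] by (auto intro!: exI[of _ "\<lambda>_. 0"])
    next
      case (lin v k)
      then obtain c where c: "\<forall>i<d. c i \<in> K" "v = (\<Sum>i<d. c i * b ^ i)" by auto
      obtain m where m: "d = Suc m" using d(1) by (cases d) auto
      \<comment> \<open>Multiplication by \<open>b\<close> shifts the coefficients up by one; the
        top one, at \<open>m\<close>, meets \<open>b ^ d\<close> and wraps around to position 0,
        where \<open>k\<close> is added.\<close>
      define c' where "c' i = (if i = 0 then c m * b ^ d + k else c (i - 1))" for i
      have "v * b + k = (\<Sum>i<d. c' i * b ^ i)"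
      proof -
        have "v * b = (\<Sum>i<m. c i * b ^ Suc i) + c m * b ^ d"
          by (simp add: c m sum_distrib_left algebra_simps)
        moreover have "(\<Sum>i<d. c' i * b ^ i) = c' 0 + (\<Sum>i<m. c' (Suc i) * b ^ Suc i)"
          unfolding m sum.lessThan_Suc_shift by simp
        ultimately show ?thesis
          by (simp add: c'_def)
      qed
      moreover have "\<forall>i<d. c' i \<in> K"
        using c m d lin(2) is_subfieldD[OF K] by (auto simp: c'_def)
      ultimately show ?case by auto
    qed
  next
    fix v assume "v \<in> ?S"
    then show "v \<in> radical_extension K [b]"
      using E by (auto intro!: is_subfield_sum[OF E(1)] is_subfieldD[OF E(1)])
  qed
  moreover have "\<forall>i\<in>{..<d}. c i = 0" if c: "\<forall>i\<in>{..<d}. c i \<in> K" "(\<Sum>i<d. c i * b ^ i) = 0" for c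
  proof -
    \<comment> \<open>A linear relation among the powers is a polynomial over \<open>K\<close> of
      degree below \<open>d\<close> vanishing at \<open>b\<close>.\<close>
    define p where "p = (\<Sum>i<d. monom (c i) i)"
    have coeff: "coeff p i = (if i < d then c i else 0)" for i
      by (simp add: p_def coeff_sum coeff_monom)
    have "degree p < d"
      using degree_lessI[of p d] coeff d(1) by auto
    moreover have "poly p b = 0"
      using c(2) by (simp add: p_def poly_sum poly_monom)
    ultimately have "p = 0"
      using c is_subfieldD(1)[OF K] by (intro real_radical_degree[OF K d(2,3)]) (auto simp: coeff)
    then show ?thesis
      using coeff by (metis coeff_0 lessThan_iff)
  qed
  ultimately show ?thesis
    using frame_of_unique_representation[OF K, of "{..<d}" "radical_extension K [b]" "\<lambda>i. b ^ i"] by (simp add: Ball_def)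
qed

lemma frame_trace_real_radical:
  fixes b :: real and I :: "nat set"
  assumes K: "is_subfield K" and xs: "\<forall>x\<in>set xs. \<exists>n>0. x ^ n \<in> K"
    and \<phi>: "frame K (radical_extension K xs) I e \<phi>"
    and b: "b \<in> radical_extension K xs" "b \<notin> K" "n > 0" "b ^ n \<in> K"
  shows "frame_trace I e \<phi> b = 0"
proof -
  define d where "d = (LEAST n. n > 0 \<and> b ^ n \<in> K)"
  have d: "d > 0" "b ^ d \<in> K"
    using LeastI[of "\<lambda>n. n > 0 \<and> b ^ n \<in> K" n] b by (auto simp: d_def)
  have min: "b ^ k \<notin> K" if "0 < k" "k < d" for k
    using not_less_Least[of k "\<lambda>n. n > 0 \<and> b ^ n \<in> K"] that by (auto simp: d_def)
  have "d \<noteq> 1" using d b by auto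
  define E where "E = radical_extension K [b]"
  define F where "F = radical_extension K xs"
  have E: "is_subfield E" "K \<subseteq> E" "b \<in> E"
    using radical_extension[OF K, of "[b]"] d by (auto simp: E_def)
  have F: "is_subfield F" "K \<subseteq> F" "set xs \<subseteq> F"
    using radical_extension[OF K xs] by (auto simp: F_def)
  have "E \<subseteq> F"
    unfolding E_def using radical_extension(4)[OF K, of "[b]" F] F b d by (auto simp: F_def)
  have xsE: "\<forall>x\<in>set xs. \<exists>n>0. x ^ n \<in> E"
    using xs \<open>K \<subseteq> E\<close> by blast
  \<comment> \<open>The same radicals generate \<open>F\<close> over \<open>E\<close>, so the upper
    step of the tower has a finite frame as well.\<close>
  have "radical_extension E xs = F"
    using radical_extension(4)[OF E(1) xsE F(1) \<open>E \<subseteq> F\<close> F(3)] radical_extension(5)[OF K xs \<open>K \<subseteq> E\<close>]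
    by (auto simp: F_def)
  then obtain J :: "nat set" and f \<psi> where \<psi>: "frame E F J f \<psi>"
    using radical_extension(6)[OF E(1) xsE] by auto
  obtain \<chi> where \<chi>: "frame K E {..<d} (\<lambda>i. b ^ i) \<chi>"
    and coord: "\<And>c i. \<lbrakk>\<forall>i<d. c i \<in> K; i < d\<rbrakk> \<Longrightarrow> \<chi> i (\<Sum>i<d. c i * b ^ i) = c i"
    using frame_of_real_radical[OF K d min] unfolding E_def by blast
  \<comment> \<open>These are the diagonal entries of multiplication by \<open>b\<close>. It sends
    \<open>b ^ i\<close> to the next power, and the last one to \<open>b ^ d\<close> times the power
    0; since \<open>d\<close> is not 1, the last power is not also the first.\<close>
  have "\<chi> i (b * b ^ i) = 0" if "i < d" for i
  proof (cases "Suc i < d")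
    case True
    have "(\<Sum>j<d. (if j = Suc i then 1 else 0) * b ^ j) = b * b ^ i"
      using True by (simp add: if_distrib[of "\<lambda>x. x * _"] cong: if_cong)
    then show ?thesis
      using coord[of "\<lambda>j. if j = Suc i then 1 else 0" i] that is_subfieldD[OF K] by simp
  next
    case False
    then have i: "Suc i = d" "i \<noteq> 0" using that \<open>d \<noteq> 1\<close> by auto
    have "(\<Sum>j<d. (if j = 0 then b ^ d else 0) * b ^ j) = b * b ^ i"
      using d(1) by (simp add: if_distrib[of "\<lambda>x. x * _"] i(1)[symmetric] cong: if_cong)
    then show ?thesis
      using coord[of "\<lambda>j. if j = 0 then b ^ d else 0" i] that is_subfieldD[OF K] d i(2) by simp
  qed
  then have "frame_trace {..<d} (\<lambda>i. b ^ i) \<chi> b = 0"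
    by (simp add: frame_trace_def)
  \<comment> \<open>The given frame and the tower frame both belong to \<open>F\<close> over
    \<open>K\<close>, so the trace can be computed in the latter.\<close>
  moreover have "frame_trace I e \<phi> b =
    frame_trace ({..<d} \<times> J) (\<lambda>(i, j). b ^ i * f j) (\<lambda>(i, j) v. \<chi> i (\<psi> j v)) b"
    using frame_trace_unique[OF \<phi>[folded F_def] frame_tower(1)[OF \<psi> \<chi> E(1) F(1) \<open>K \<subseteq> E\<close> \<open>E \<subseteq> F\<close>] F(1,2)]
      b(1) by (simp add: F_def)
  ultimately show ?thesis
    using frame_tower(2)[OF \<psi> \<chi> E(1) F(1) \<open>K \<subseteq> E\<close> \<open>E \<subseteq> F\<close> E(3)] by simp
qed

section \<open>From vanishing traces to linear independence\<close>

theorem theorem1: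
  fixes K L A :: "real set"
  assumes "is_subfield K" and "is_subfield L" and "K \<subseteq> L"
    and "A \<in> theta K L"
  shows "lin_independent_over K A"
proof (rule ccontr)
  note K = \<open>is_subfield K\<close>
  have radical: "\<exists>n>0. a ^ n \<in> K" if "a \<in> A" for a
    using assms(4) that by (auto simp: theta_def)
  have pair: "lin_independent_over K {a, b}" if "a \<in> A" "b \<in> A" "a \<noteq> b" for a b
    using assms(4) that by (auto simp: theta_def pairwise_def)
  have not_single: "A \<noteq> {a}" for a
    using assms(4) by (auto simp: theta_def)
  assume "\<not> lin_independent_over K A"
  then obtain T c u where T: "finite T" "T \<subseteq> A" and c: "\<forall>v\<in>T. c v \<in> K" "(\<Sum>v\<in>T. c v * v) = 0"
    and u: "u \<in> T" "c u \<noteq> 0"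
    unfolding lin_independent_over_def by blast
  \<comment> \<open>As \<open>A\<close> has a second element, \<open>u\<close> belongs to an
    independent pair, which cannot contain 0.\<close>
  have "u \<noteq> 0"
  proof
    assume "u = 0"
    obtain w where "w \<in> A" "w \<noteq> u"
      using not_single[of u] u T by blast
    then have "lin_independent_over K {u, w}"
      using pair u T by auto
    from lin_independent_overD[OF this, of "{u}" "\<lambda>_. 1" u] show False
      using \<open>u = 0\<close> is_subfieldD(2)[OF K] by simp
  qed
  obtain xs where xs: "set xs = T"
    using finite_list[OF T(1)] by blast
  have rad: "\<forall>x\<in>set xs. \<exists>n>0. x ^ n \<in> K"
    using radical xs T by blast
  define F where "F = radical_extension K xs"
  have F: "is_subfield F" "K \<subseteq> F" "T \<subseteq> F"
    using radical_extension[OF K rad] xs by (auto simp: F_def)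
  obtain I :: "nat set" and e \<phi> where \<phi>: "frame K F I e \<phi>"
    using radical_extension(6)[OF K rad] unfolding F_def by blast
  have e: "e i \<in> F" "\<phi> i (e i) = 1" if "i \<in> I" for i
    using \<phi> that by (auto simp: frame_def)
  \<comment> \<open>The terms of the relation divided by the term of \<open>u\<close>: they sum to
    0, and \<open>q u\<close> is 1.\<close>
  define q where "q v = (c v * v) / (c u * u)" for v
  have q: "q v \<in> F" if "v \<in> T" for v
    unfolding q_def using that u c F by (auto intro!: is_subfieldD[OF F(1)])
  have trace_q: "frame_trace I e \<phi> (q v) = 0" if v: "v \<in> T" "v \<noteq> u" "c v \<noteq> 0" for v
  proof -
    have cvK: "c v \<in> K" "c u \<in> K"
      using c v u by auto
    have "q v \<notin> K"
    proof
      assume "q v \<in> K"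
      \<comment> \<open>If \<open>q v\<close> were in \<open>K\<close>, then c v * v = (q v * c u) *
        u would be a relation between \<open>u\<close> and \<open>v\<close>; \<open>a\<close>
        collects its coefficients.\<close>
      define a where "a w = (if w = u then q v * c u else - c v)" for w
      have "\<forall>w\<in>{u, v}. a w \<in> K"
        using cvK \<open>q v \<in> K\<close> by (auto simp: a_def intro!: is_subfieldD[OF K])
      moreover have "(\<Sum>w\<in>{u, v}. a w * w) = 0"
        using v \<open>u \<noteq> 0\<close> u(2) by (simp add: a_def q_def)
      moreover have "lin_independent_over K {u, v}"
        using pair v u T by auto
      ultimately have "a v = 0"
        by (intro lin_independent_overD[of K "{u, v}" "{u, v}" a v]) simp_all
      then show False
        using v by (simp add: a_def)
    qed
    obtain m where m: "m > 0" "v ^ m \<in> K"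
      using radical[of v] v T by blast
    obtain n where n: "n > 0" "u ^ n \<in> K"
      using radical[of u] u T by blast
    \<comment> \<open>The product of the two exponents brings both \<open>v\<close> and
      \<open>u\<close> into \<open>K\<close>, so \<open>q v\<close> is a radical too.\<close>
    have "q v ^ (m * n) = (c v ^ (m * n) * (v ^ m) ^ n) / (c u ^ (m * n) * (u ^ n) ^ m)"
      by (simp add: q_def power_divide power_mult_distrib power_mult[symmetric] mult.commute)
    also have "\<dots> \<in> K"
      by (intro is_subfieldD(4,8)[OF K])
        (rule is_subfieldD(9)[OF K cvK(1)] is_subfieldD(9)[OF K cvK(2)]
          is_subfieldD(9)[OF K m(2)] is_subfieldD(9)[OF K n(2)])+
    finally have "q v ^ (m * n) \<in> K" .
    then show "frame_trace I e \<phi> (q v) = 0"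
      using frame_trace_real_radical[OF K rad \<phi>[unfolded F_def], of "q v" "m * n"]
        m n q[OF v(1)] \<open>q v \<notin> K\<close> unfolding F_def by simp
  qed
  have zero: "frame_trace I e \<phi> 0 = 0"
    using frame_sum[OF \<phi> F(1), of _ "{}"] by (simp add: frame_trace_def)
  have "0 = frame_trace I e \<phi> (\<Sum>v\<in>T. q v)"
    using c(2) zero by (simp add: q_def sum_divide_distrib[symmetric])
  also have "\<dots> = (\<Sum>i\<in>I. \<Sum>v\<in>T. \<phi> i (q v * e i))"
    unfolding frame_trace_def sum_distrib_right
    by (intro sum.cong refl frame_sum[OF \<phi> F(1)] is_subfieldD(4)[OF F(1)] q e)
  also have "\<dots> = (\<Sum>v\<in>T. frame_trace I e \<phi> (q v))"
    unfolding frame_trace_def by (rule sum.swap)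
  also have "\<dots> = frame_trace I e \<phi> (q u) + (\<Sum>v\<in>T - {u}. frame_trace I e \<phi> (q v))"
    by (rule sum.remove) (use T u in auto)
  also have "(\<Sum>v\<in>T - {u}. frame_trace I e \<phi> (q v)) = 0"
  proof (intro sum.neutral ballI)
    fix v assume "v \<in> T - {u}"
    then show "frame_trace I e \<phi> (q v) = 0"
      \<comment> \<open>A term with coefficient 0 gives \<open>q v = 0\<close>, whose trace vanishes
        trivially; \<open>trace_q\<close> handles the others.\<close>
      by (cases "c v = 0") (use zero trace_q in \<open>auto simp: q_def\<close>)
  qed
  also have "q u = 1"
    using u \<open>u \<noteq> 0\<close> by (simp add: q_def)
  also have "frame_trace I e \<phi> 1 = of_nat (card I)"
    by (simp add: frame_trace_def e)
  \<comment> \<open>In characteristic 0 the equation forces \<open>card I = 0\<close>. Over an empty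
    frame every element of \<open>F\<close> is an empty sum, which contradicts 1 being in
    \<open>F\<close>.\<close>
  finally have "I = {}"
    using \<phi> by (simp add: frame_def)
  with \<phi> have "v = 0" if "v \<in> F" for v
    using that by (simp add: frame_def)
  then show False
    using is_subfieldD(2)[OF F(1)] one_neq_zero by blast
qed

end
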